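(* For every sampling-based inventory-agnostic policy $\mu$, every $j\in\mathcal J$ and every $t\in\mathcal T$, $$\mathrm{rev}(\mu)\;\le\;\max_{S\in\Omega^\mu_{jt}}\mathrm{rev}(M_{jt}(\mu,S)).$$
   Context: Model. Products $\mathcal N=\{1,\dots,n\}$; product $i$ has revenue $r_i\ge 0$ and initial inventory $c_i\in\mathbb Z_+$. Customer types $\mathcal J=\{1,\dots,m\}$; time periods $\mathcal T=\{1,\dots,T\}$. At each period $t$ exactly one customer arrives, of type $j$ with probability $\lambda_{jt}\ge0$, $\sum_{j\in\mathcal J}\lambda_{jt}=1$; arrivals and choices at different periods are independent. If assortment $S\subseteq\mathcal N$ is offered to a type-$j$ customer, she chooses product $i$ with probability $\phi_{ij}(S)\ge0$ and chooses nothing with probability $1-\sum_{i\in\mathcal N}\phi_{ij}(S)\ge 0$; $\phi_{ij}(S)=0$ for $i\notin S$. Substitutability: $\phi_{ij}(S\cup\{\ell\})\le\phi_{ij}(S)$ for all $i\in S$, $\ell\notin S$, $j\in\mathcal J$, $S\subseteq\mathcal N$. Policies. A sampling-based inventory-agnostic policy $\mu$ is given by mutually independent random assortments $(S^\mu_{jt}: j\in\mathcal J, t\in\mathcal T)$, independent of arrivals and choices; if a type-$j$ customer arrives at period $t$, the assortment $S^\mu_{jt}$ is offered regardless of remaining inventories. If the customer chooses a product with no remaining inventory she leaves without a purchase; otherwise, if she chooses product $i$, one unit of its inventory is consumed and revenue $r_i$ is collected. $\mathrm{rev}(\mu)$ is the total expected revenue of $\mu$ over the selling horizon. Explicitly,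 with $\varphi^\mu_{it}=\sum_{j}\lambda_{jt}\sum_{S}\mathbb P\{S^\mu_{jt}=S\}\phi_{ij}(S)$ and, for each $i$, independent Bernoulli random variables $B^\mu_{it}$ ($t\in\mathcal T$) with parameters $\varphi^\mu_{it}$, $\mathrm{rev}(\mu)=\sum_{i}r_i\,\mathbb E\{\min\{c_i,\sum_{t\in\mathcal T}B^\mu_{it}\}\}$. $\Omega^\mu_{jt}=\{S\subseteq\mathcal N:\mathbb P\{S^\mu_{jt}=S\}>0\}$ is the support of $S^\mu_{jt}$. $M_{jt}(\mu,S)$ denotes the policy obtained from $\mu$ by replacing the random assortment $S^\mu_{jt}$ with the deterministic assortment $S$, keeping all else unchanged. *)

theory Defs
  imports "HOL-Probability.Probability"
begin

section \<open>Problem instances\<close>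

record instance_data =
  num_products :: nat
  num_types :: nat
  horizon :: nat
  revenue :: "nat \<Rightarrow> real"
  inventory :: "nat \<Rightarrow> nat"
  arrival_prob :: "nat \<Rightarrow> nat \<Rightarrow> real"                \<comment> \<open>type \<open>j\<close>, period \<open>t\<close>\<close>
  choice_prob :: "nat \<Rightarrow> nat \<Rightarrow> nat set \<Rightarrow> real"    \<comment> \<open>product \<open>i\<close>, type \<open>j\<close>, assortment \<open>S\<close>\<close>

definition products :: "instance_data \<Rightarrow> nat set" where
  "products I = {1..num_products I}"

definition types :: "instance_data \<Rightarrow> nat set" where
  "types I = {1..num_types I}"

definition periods :: "instance_data \<Rightarrow> nat set" where
  "periods I = {1..horizon I}"

definition valid_arrivals :: "instance_data \<Rightarrow> bool" where
  "valid_arrivals I \<longleftrightarrow>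
     (\<forall>t\<in>periods I. (\<forall>j\<in>types I. arrival_prob I j t \<ge> 0) \<and>
                    (\<Sum>j\<in>types I. arrival_prob I j t) = 1)"

definition valid_choices :: "instance_data \<Rightarrow> bool" where
  "valid_choices I \<longleftrightarrow>
     (\<forall>j\<in>types I. \<forall>S. S \<subseteq> products I \<longrightarrow>
        (\<forall>i\<in>products I. choice_prob I i j S \<ge> 0) \<and>
        (\<forall>i\<in>products I. i \<notin> S \<longrightarrow> choice_prob I i j S = 0) \<and>
        1 - (\<Sum>i\<in>products I. choice_prob I i j S) \<ge> 0)"

definition substitutable :: "instance_data \<Rightarrow> bool" where
  "substitutable I \<longleftrightarrow>
     (\<forall>j\<in>types I. \<forall>S. S \<subseteq> products I \<longrightarrow>
        (\<forall>i\<in>S. \<forall>l\<in>products I - S. choice_prob I i j (insert l S) \<le> choice_prob I i j S))"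

definition valid_instance :: "instance_data \<Rightarrow> bool" where
  "valid_instance I \<longleftrightarrow>
     (\<forall>i\<in>products I. revenue I i \<ge> 0) \<and>
     valid_arrivals I \<and> valid_choices I \<and> substitutable I"

section \<open>Policies\<close>

text \<open>
  The random assortments of a policy are mutually independent and independent of arrivals and
  choices, so the policy is determined by the marginal laws: \<open>\<mu> j t\<close> is the law of the assortment
  offered to a type \<open>j\<close> customer in period \<open>t\<close>. The independence is realised in
  \<open>choice_process\<close> below.
\<close>

type_synonym policy = "nat \<Rightarrow> nat \<Rightarrow> nat set pmf"

definition valid_policy :: "instance_data \<Rightarrow> policy \<Rightarrow> bool" where
  "valid_policy I \<mu> \<longleftrightarrow> (\<forall>j\<in>types I. \<forall>t\<in>periods I. set_pmf (\<mu> j t) \<subseteq> Pow (products I))"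

definition support :: "instance_data \<Rightarrow> policy \<Rightarrow> nat \<Rightarrow> nat \<Rightarrow> nat set set" where
  "support I \<mu> j t = {S. S \<subseteq> products I \<and> measure_pmf.prob (\<mu> j t) {S} > 0}"

definition replace_assortment :: "nat \<Rightarrow> nat \<Rightarrow> policy \<Rightarrow> nat set \<Rightarrow> policy" where
  "replace_assortment j t \<mu> S = \<mu>(j := (\<mu> j)(t := return_pmf S))"

section \<open>The selling process\<close>

definition arrival_pmf :: "instance_data \<Rightarrow> nat \<Rightarrow> nat pmf" where
  "arrival_pmf I t = embed_pmf (\<lambda>j. if j \<in> types I then arrival_prob I j t else 0)"

text \<open>\<^term>\<open>None\<close> stands for choosing nothing.\<close>

definition choice_pmf :: "instance_data \<Rightarrow> nat \<Rightarrow> nat set \<Rightarrow> nat option pmf" where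
  "choice_pmf I j S = embed_pmf (\<lambda>x. case x of
       None \<Rightarrow> 1 - (\<Sum>i\<in>products I. choice_prob I i j S)
     | Some i \<Rightarrow> (if i \<in> products I then choice_prob I i j S else 0))"

text \<open>
  Joint law of the customers' choices, one per period: the whole family of assortments is drawn
  independently, the arriving types are drawn independently of it, and then each arriving customer
  chooses from the assortment drawn for her type and period.
\<close>

definition choice_process :: "instance_data \<Rightarrow> policy \<Rightarrow> (nat \<Rightarrow> nat option) pmf" where
  "choice_process I \<mu> = do {
     A \<leftarrow> Pi_pmf (types I \<times> periods I) {} (\<lambda>(j, t). \<mu> j t);
     a \<leftarrow> Pi_pmf (periods I) 0 (arrival_pmf I);
     Pi_pmf (periods I) None (\<lambda>t. choice_pmf I (a t) (A (a t, t)))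
   }"

text \<open>
  Revenue collected along a sequence of choices when the inventories are initially \<open>c\<close>; a customer
  choosing a product that is out of stock leaves without a purchase.
\<close>

fun path_revenue :: "(nat \<Rightarrow> real) \<Rightarrow> (nat \<Rightarrow> nat) \<Rightarrow> nat option list \<Rightarrow> real" where
  "path_revenue r c [] = 0"
| "path_revenue r c (None # xs) = path_revenue r c xs"
| "path_revenue r c (Some i # xs) =
     (if c i = 0 then path_revenue r c xs else r i + path_revenue r (c(i := c i - 1)) xs)"

definition expected_revenue :: "instance_data \<Rightarrow> policy \<Rightarrow> real" where
  "expected_revenue I \<mu> = measure_pmf.expectation (choice_process I \<mu>)
     (\<lambda>ch. path_revenue (revenue I) (inventory I) (map ch [1..<Suc (horizon I)]))"

section \<open>Closed form of the total expected revenue\<close>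

definition purchase_prob :: "instance_data \<Rightarrow> policy \<Rightarrow> nat \<Rightarrow> nat \<Rightarrow> real" where
  "purchase_prob I \<mu> i t = (\<Sum>j\<in>types I. arrival_prob I j t *
     (\<Sum>S\<in>Pow (products I). pmf (\<mu> j t) S * choice_prob I i j S))"

lemma finite_products [simp, intro]: "finite (products I)"
  and finite_types [simp, intro]: "finite (types I)"
  and finite_periods [simp, intro]: "finite (periods I)"
  by (simp_all add: products_def types_def periods_def)

lemma nn_integral_count_space_finite_support:
  fixes f :: "'a \<Rightarrow> real"
  assumes "finite A" "\<And>x. f x \<ge> 0" "\<And>x. x \<notin> A \<Longrightarrow> f x = 0"
  shows "(\<integral>\<^sup>+x. ennreal (f x) \<partial>count_space UNIV) = ennreal (\<Sum>x\<in>A. f x)"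
proof -
  have "(\<integral>\<^sup>+x. ennreal (f x) \<partial>count_space UNIV) = (\<Sum>x\<in>A. ennreal (f x))"
    using assms by (intro nn_integral_count_space') auto
  also have "\<dots> = ennreal (\<Sum>x\<in>A. f x)"
    using assms by (intro sum_ennreal) auto
  finally show ?thesis .
qed

lemma pmf_arrival_pmf:
  assumes "valid_arrivals I" "t \<in> periods I"
  shows "pmf (arrival_pmf I t) j = (if j \<in> types I then arrival_prob I j t else 0)"
proof -
  let ?f = "\<lambda>j. if j \<in> types I then arrival_prob I j t else 0"
  have nonneg: "?f x \<ge> 0" for x
    using assms by (auto simp: valid_arrivals_def)
  have "(\<integral>\<^sup>+x. ennreal (?f x) \<partial>count_space UNIV) = ennreal (\<Sum>x\<in>types I. ?f x)"
    using nonneg by (intro nn_integral_count_space_finite_support) auto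
  also have "(\<Sum>x\<in>types I. ?f x) = 1"
    using assms by (simp add: valid_arrivals_def)
  finally show ?thesis
    unfolding arrival_pmf_def using nonneg by (subst pmf_embed_pmf) auto
qed

lemma set_arrival_pmf:
  assumes "valid_arrivals I" "t \<in> periods I"
  shows "set_pmf (arrival_pmf I t) \<subseteq> types I"
  using pmf_arrival_pmf[OF assms] by (auto simp: set_pmf_eq split: if_splits)

lemma pmf_choice_pmf:
  assumes "valid_choices I" "j \<in> types I" "S \<subseteq> products I"
  shows "pmf (choice_pmf I j S) x = (case x of
       None \<Rightarrow> 1 - (\<Sum>i\<in>products I. choice_prob I i j S)
     | Some i \<Rightarrow> (if i \<in> products I then choice_prob I i j S else 0))"
proof -
  let ?f = "\<lambda>x. case x of
       None \<Rightarrow> 1 - (\<Sum>i\<in>products I. choice_prob I i j S)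
     | Some i \<Rightarrow> (if i \<in> products I then choice_prob I i j S else 0)"
  have nonneg: "?f x \<ge> 0" for x
    using assms by (fastforce simp: valid_choices_def split: option.splits)
  have "(\<integral>\<^sup>+x. ennreal (?f x) \<partial>count_space UNIV)
      = ennreal (\<Sum>x\<in>insert None (Some ` products I). ?f x)"
    using nonneg
    by (intro nn_integral_count_space_finite_support) (auto split: option.splits)
  also have "(\<Sum>x\<in>insert None (Some ` products I). ?f x) = 1"
    by (simp add: sum.reindex)
  finally show ?thesis
    unfolding choice_pmf_def using nonneg by (subst pmf_embed_pmf) auto
qed

lemma set_choice_pmf:
  assumes "valid_choices I" "j \<in> types I" "S \<subseteq> products I"
  shows "set_pmf (choice_pmf I j S) \<subseteq> insert None (Some ` products I)"
proof
  fix x assume "x \<in> set_pmf (choice_pmf I j S)"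
  then have "pmf (choice_pmf I j S) x \<noteq> 0" by (simp add: set_pmf_iff)
  then show "x \<in> insert None (Some ` products I)"
    unfolding pmf_choice_pmf[OF assms] by (cases x) (auto split: if_splits)
qed

lemma Pi_pmf_pullback:
  assumes "finite A" "finite B" "inj_on h A" "h ` A \<subseteq> B"
  shows "map_pmf (\<lambda>f x. if x \<in> A then f (h x) else d) (Pi_pmf B d' p) = Pi_pmf A d (\<lambda>x. p (h x))"
  using assms
proof (induction A arbitrary: B rule: finite_induct)
  case empty
  then show ?case by simp
next
  case (insert a A)
  define B' where "B' = B - {h a}"
  have B: "B = insert (h a) B'" and fin: "finite B'" and notin: "h a \<notin> B'"
    using insert.prems by (auto simp: B'_def)
  have sub: "h ` A \<subseteq> B'" and ha: "\<And>x. x \<in> A \<Longrightarrow> h x \<noteq> h a"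
    using insert.prems insert.hyps by (auto simp: B'_def inj_on_def)
  have IH: "Pi_pmf A d (\<lambda>x. p (h x)) = map_pmf (\<lambda>f x. if x \<in> A then f (h x) else d) (Pi_pmf B' d' p)"
    using insert.IH[OF fin _ sub] insert.prems by (simp add: inj_on_def)
  have eq: "(\<lambda>x. if x \<in> insert a A then (f(h a := y)) (h x) else d)
      = (\<lambda>x. if x \<in> A then f (h x) else d)(a := y)" for f :: "'b \<Rightarrow> 'c" and y
    using ha insert.hyps by (auto simp: fun_eq_iff)
  show ?case
    unfolding B Pi_pmf_insert'[OF fin notin] Pi_pmf_insert'[OF insert.hyps] IH
    by (simp only: map_bind_pmf bind_map_pmf map_return_pmf eq)
qed

definition period_choice_pmf :: "instance_data \<Rightarrow> policy \<Rightarrow> nat \<Rightarrow> nat option pmf" where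
  "period_choice_pmf I \<mu> t = do {j \<leftarrow> arrival_pmf I t; S \<leftarrow> \<mu> j t; choice_pmf I j S}"

lemma choice_process_eq:
  assumes "valid_arrivals I"
  shows "choice_process I \<mu> = Pi_pmf (periods I) None (period_choice_pmf I \<mu>)"
proof -
  let ?T = "periods I"
  have inner: "Pi_pmf (types I \<times> ?T) {} (\<lambda>(j, t). \<mu> j t) \<bind>
        (\<lambda>A. Pi_pmf ?T None (\<lambda>t. choice_pmf I (a t) (A (a t, t))))
      = Pi_pmf ?T None (\<lambda>t. \<mu> (a t) t \<bind> choice_pmf I (a t))"
    if "a \<in> set_pmf (Pi_pmf ?T 0 (arrival_pmf I))" for a
  proof -
    have a: "a t \<in> types I" if "t \<in> ?T" for t
    proof -
      have "a t \<in> set_pmf (arrival_pmf I t)"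
        using \<open>a \<in> _\<close> \<open>t \<in> ?T\<close> by (auto simp: set_Pi_pmf PiE_dflt_def)
      then show ?thesis using set_arrival_pmf[OF assms that] by blast
    qed
    have "Pi_pmf ?T None (\<lambda>t. \<mu> (a t) t \<bind> choice_pmf I (a t))
        = Pi_pmf ?T {} (\<lambda>t. \<mu> (a t) t) \<bind> (\<lambda>f. Pi_pmf ?T None (\<lambda>t. choice_pmf I (a t) (f t)))"
      by (rule Pi_pmf_bind) simp
    also have "Pi_pmf ?T {} (\<lambda>t. \<mu> (a t) t)
        = map_pmf (\<lambda>f t. if t \<in> ?T then f (a t, t) else {})
            (Pi_pmf (types I \<times> ?T) {} (\<lambda>(j, t). \<mu> j t))"
      using a by (subst Pi_pmf_pullback) (auto simp: inj_on_def)
    finally show ?thesis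
      by (auto simp: bind_map_pmf intro!: bind_pmf_cong Pi_pmf_cong)
  qed
  have "choice_process I \<mu> = Pi_pmf ?T 0 (arrival_pmf I) \<bind>
      (\<lambda>a. Pi_pmf (types I \<times> ?T) {} (\<lambda>(j, t). \<mu> j t) \<bind>
        (\<lambda>A. Pi_pmf ?T None (\<lambda>t. choice_pmf I (a t) (A (a t, t)))))"
    unfolding choice_process_def by (rule bind_commute_pmf)
  also have "\<dots> = Pi_pmf ?T 0 (arrival_pmf I) \<bind>
      (\<lambda>a. Pi_pmf ?T None (\<lambda>t. \<mu> (a t) t \<bind> choice_pmf I (a t)))"
    by (intro bind_pmf_cong refl inner)
  also have "\<dots> = Pi_pmf ?T None (period_choice_pmf I \<mu>)"
    unfolding period_choice_pmf_def by (rule Pi_pmf_bind[symmetric]) simp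
  finally show ?thesis .
qed

lemma set_period_choice_pmf:
  assumes "valid_arrivals I" "valid_choices I" "valid_policy I \<mu>" "t \<in> periods I"
  shows "set_pmf (period_choice_pmf I \<mu> t) \<subseteq> insert None (Some ` products I)"
proof
  fix x assume "x \<in> set_pmf (period_choice_pmf I \<mu> t)"
  then obtain j S where j: "j \<in> set_pmf (arrival_pmf I t)" and S: "S \<in> set_pmf (\<mu> j t)"
    and x: "x \<in> set_pmf (choice_pmf I j S)"
    by (auto simp: period_choice_pmf_def)
  have j': "j \<in> types I" using set_arrival_pmf[OF assms(1,4)] j by blast
  have "S \<subseteq> products I" using assms(3,4) j' S by (auto simp: valid_policy_def)
  then show "x \<in> insert None (Some ` products I)"
    using set_choice_pmf[OF assms(2) j'] x by blast
qed

lemma pmf_period_choice_pmf: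
  assumes "valid_arrivals I" "valid_choices I" "valid_policy I \<mu>" "t \<in> periods I" "i \<in> products I"
  shows "pmf (period_choice_pmf I \<mu> t) (Some i) = purchase_prob I \<mu> i t"
proof -
  have inner: "pmf (\<mu> j t \<bind> choice_pmf I j) (Some i)
      = (\<Sum>S\<in>Pow (products I). pmf (\<mu> j t) S * choice_prob I i j S)" if "j \<in> types I" for j
  proof -
    have "pmf (\<mu> j t \<bind> choice_pmf I j) (Some i)
        = (\<Sum>S\<in>Pow (products I). pmf (choice_pmf I j S) (Some i) * pmf (\<mu> j t) S)"
      unfolding pmf_bind
      using assms that by (intro integral_measure_pmf_real) (auto simp: valid_policy_def)
    also have "\<dots> = (\<Sum>S\<in>Pow (products I). pmf (\<mu> j t) S * choice_prob I i j S)"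
      using assms that by (intro sum.cong) (auto simp: pmf_choice_pmf)
    finally show ?thesis .
  qed
  have "pmf (period_choice_pmf I \<mu> t) (Some i)
      = (\<Sum>j\<in>types I. pmf (\<mu> j t \<bind> choice_pmf I j) (Some i) * pmf (arrival_pmf I t) j)"
    unfolding period_choice_pmf_def pmf_bind[of "arrival_pmf I t"]
    using set_arrival_pmf[OF assms(1,4)] by (intro integral_measure_pmf_real) auto
  also have "\<dots> = purchase_prob I \<mu> i t"
    unfolding purchase_prob_def using assms
    by (intro sum.cong) (simp_all add: inner pmf_arrival_pmf)
  finally show ?thesis .
qed

lemma path_revenue_eq:
  assumes "finite N" "set xs \<subseteq> insert None (Some ` N)"
  shows "path_revenue r c xs = (\<Sum>i\<in>N. r i * real (min (c i) (count_list xs (Some i))))"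
  using assms(2)
proof (induction r c xs rule: path_revenue.induct)
  case (1 r c)
  then show ?case by simp
next
  case (2 r c xs)
  then show ?case by simp
next
  case (3 r c k xs)
  have k: "k \<in> N" using 3 by auto
  show ?case
  proof (cases "c k = 0")
    case True
    then have "path_revenue r c (Some k # xs)
        = (\<Sum>i\<in>N. r i * real (min (c i) (count_list xs (Some i))))"
      using 3 by simp
    also have "\<dots> = (\<Sum>i\<in>N. r i * real (min (c i) (count_list (Some k # xs) (Some i))))"
      using True by (intro sum.cong) auto
    finally show ?thesis .
  next
    case False
    let ?c = "c(k := c k - 1)"
    have "path_revenue r c (Some k # xs)
        = r k + (\<Sum>i\<in>N. r i * real (min (?c i) (count_list xs (Some i))))"
      using 3 False by (simp del: fun_upd_apply)
    also have "\<dots> = (\<Sum>i\<in>N. (if i = k then r i else 0) + r i * real (min (?c i) (count_list xs (Some i))))"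
      using k assms(1) by (simp add: sum.distrib)
    also have "\<dots> = (\<Sum>i\<in>N. r i * real (min (c i) (count_list (Some k # xs) (Some i))))"
    proof (intro sum.cong refl)
      fix i assume "i \<in> N"
      have "real (min (c k) (Suc m)) = 1 + real (min (c k - 1) m)" for m
        using False by (simp add: min_def of_nat_diff) linarith
      then show "(if i = k then r i else 0) + r i * real (min (?c i) (count_list xs (Some i)))
          = r i * real (min (c i) (count_list (Some k # xs) (Some i)))"
        by (auto simp: algebra_simps)
    qed
    finally show ?thesis .
  qed
qed

lemma map_pmf_eq_bernoulli: "map_pmf (\<lambda>y. y = x) p = bernoulli_pmf (pmf p x)"
proof -
  have "map_pmf (\<lambda>y. y = x) p = bernoulli_pmf (pmf (map_pmf (\<lambda>y. y = x) p) True)"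
  proof (rule pmf_eqI)
    fix b :: bool
    let ?q = "map_pmf (\<lambda>y. y = x) p"
    have "pmf ?q True + pmf ?q False = 1"
      by (simp add: pmf_False_conv_True)
    then show "pmf ?q b = pmf (bernoulli_pmf (pmf ?q True)) b"
      by (cases b) (simp_all add: pmf_le_1)
  qed
  also have "pmf (map_pmf (\<lambda>y. y = x) p) True = pmf p x"
    by (simp add: pmf_map vimage_def measure_pmf_single)
  finally show ?thesis .
qed

lemma count_list_map_upt:
  "count_list (map ch [1..<Suc n]) x = (\<Sum>t\<in>{1..n}. of_bool (ch t = x))"
  by (induction n) auto

text \<open>
  The expectation over the selling process agrees with the closed form
  \<open>\<Sum>\<^sub>i r\<^sub>i E(min c\<^sub>i (\<Sum>\<^sub>t B\<^sub>i\<^sub>t))\<close> with independent Bernoulli variables \<open>B\<^sub>i\<^sub>t\<close>.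
\<close>

theorem expected_revenue_eq_closed_form:
  assumes "valid_instance I" "valid_policy I \<mu>"
  shows "expected_revenue I \<mu> = (\<Sum>i\<in>products I. revenue I i *
     measure_pmf.expectation
       (Pi_pmf (periods I) False (\<lambda>t. bernoulli_pmf (purchase_prob I \<mu> i t)))
       (\<lambda>B. real (min (inventory I i) (\<Sum>t\<in>periods I. of_bool (B t)))))"
proof -
  have va: "valid_arrivals I" and vc: "valid_choices I"
    using assms by (auto simp: valid_instance_def)
  let ?P = "choice_process I \<mu>" and ?T = "periods I"
  have fin: "finite (set_pmf ?P)"
  proof -
    have "finite (set_pmf (period_choice_pmf I \<mu> t))" if "t \<in> ?T" for t
      using set_period_choice_pmf[OF va vc assms(2) that] by (rule finite_subset) simp
    then show ?thesis
      unfolding choice_process_eq[OF va] by (simp add: set_Pi_pmf finite_PiE_dflt)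
  qed
  have path: "path_revenue (revenue I) (inventory I) (map ch [1..<Suc (horizon I)])
      = (\<Sum>i\<in>products I. revenue I i *
           real (min (inventory I i) (\<Sum>t\<in>?T. of_bool (ch t = Some i))))"
    if "ch \<in> set_pmf ?P" for ch
  proof -
    have "ch t \<in> insert None (Some ` products I)" if "t \<in> ?T" for t
      using \<open>ch \<in> _\<close> set_period_choice_pmf[OF va vc assms(2) that] that
      unfolding choice_process_eq[OF va] by (auto simp: set_Pi_pmf PiE_dflt_def)
    then have "set (map ch [1..<Suc (horizon I)]) \<subseteq> insert None (Some ` products I)"
      unfolding periods_def set_map set_upt atLeastLessThanSuc_atLeastAtMost
      by (rule image_subsetI)
    then show ?thesis
      by (simp only: path_revenue_eq[OF finite_products] count_list_map_upt periods_def)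
  qed
  have marginal: "map_pmf (\<lambda>ch t. ch t = Some i) ?P
      = Pi_pmf ?T False (\<lambda>t. bernoulli_pmf (purchase_prob I \<mu> i t))" if "i \<in> products I" for i
  proof -
    have "map_pmf (\<lambda>h. (\<lambda>y. y = Some i) \<circ> h) (Pi_pmf ?T None (period_choice_pmf I \<mu>))
        = Pi_pmf ?T False (\<lambda>t. map_pmf (\<lambda>y. y = Some i) (period_choice_pmf I \<mu> t))"
      by (rule Pi_pmf_map[symmetric]) auto
    then show ?thesis
      unfolding choice_process_eq[OF va]
      using pmf_period_choice_pmf[OF va vc assms(2) _ that]
      by (auto simp: o_def map_pmf_eq_bernoulli intro!: Pi_pmf_cong)
  qed
  have "expected_revenue I \<mu> = measure_pmf.expectation ?P (\<lambda>ch. \<Sum>i\<in>products I. revenue I i *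
           real (min (inventory I i) (\<Sum>t\<in>?T. of_bool (ch t = Some i))))"
    unfolding expected_revenue_def
  proof (rule integral_cong_AE)
    show "AE ch in ?P. path_revenue (revenue I) (inventory I) (map ch [1..<Suc (horizon I)])
      = (\<Sum>i\<in>products I. revenue I i *
           real (min (inventory I i) (\<Sum>t\<in>?T. of_bool (ch t = Some i))))"
      unfolding AE_measure_pmf_iff using path by blast
  qed simp_all
  also have "\<dots> = (\<Sum>i\<in>products I. revenue I i * measure_pmf.expectation ?P
           (\<lambda>ch. real (min (inventory I i) (\<Sum>t\<in>?T. of_bool (ch t = Some i)))))"
    using fin by (subst Bochner_Integration.integral_sum) (auto intro: integrable_measure_pmf_finite)
  also have "\<dots> = (\<Sum>i\<in>products I. revenue I i *
     measure_pmf.expectation (map_pmf (\<lambda>ch t. ch t = Some i) ?P)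
       (\<lambda>B. real (min (inventory I i) (\<Sum>t\<in>?T. of_bool (B t)))))"
    by simp
  also have "\<dots> = (\<Sum>i\<in>products I. revenue I i *
     measure_pmf.expectation
       (Pi_pmf ?T False (\<lambda>t. bernoulli_pmf (purchase_prob I \<mu> i t)))
       (\<lambda>B. real (min (inventory I i) (\<Sum>t\<in>?T. of_bool (B t)))))"
    by (intro sum.cong refl) (simp only: marginal)
  finally show ?thesis .
qed

end

theory Submission
  imports Defs
begin

text \<open>
  Since the assortments are independent, the selling process under \<open>\<mu>\<close> arises by first drawing \<open>S\<close>
  from the law of \<open>S\<^sub>j\<^sub>t\<close> and then running the process with \<open>S\<close> fixed. Hence \<open>rev(\<mu>)\<close> is a convex
  combination of the values \<open>rev(M\<^sub>j\<^sub>t(\<mu>, S))\<close> with \<open>S\<close> in the support, and is at most their maximum.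
\<close>

text \<open>Splitting off coordinate \<open>x\<close> leaves a product over the other coordinates,
  which the update at \<open>x\<close> does not affect; drawing \<open>y\<close> from
  \<open>p x\<close> and then pinning \<open>x\<close> to \<open>y\<close> restores the missing
  factor.\<close>

lemma Pi_pmf_condition_coordinate:
  assumes "finite A" "x \<in> A"
  shows "Pi_pmf A d p = p x \<bind> (\<lambda>y. Pi_pmf A d (p(x := return_pmf y)))"
proof -
  define B where "B = A - {x}"
  have A: "A = insert x B" and B: "finite B" "x \<notin> B"
    using assms by (auto simp: B_def)
  have "Pi_pmf B d (p(x := return_pmf y)) = Pi_pmf B d p" for y
    using B by (intro Pi_pmf_cong) auto
  then show ?thesis
    unfolding A Pi_pmf_insert'[OF B] by (simp add: bind_return_pmf)
qed

lemma choice_process_replace_assortment: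
  assumes "j \<in> types I" "t \<in> periods I"
  shows "choice_process I \<mu> = \<mu> j t \<bind> (\<lambda>S. choice_process I (replace_assortment j t \<mu> S))"
proof -
  \<comment> \<open>The assortment family is indexed by pairs, but policies are curried, so the two
    kinds of update must be matched.\<close>
  have upd: "(\<lambda>(j', t'). \<mu> j' t')((j, t) := return_pmf S)
      = (\<lambda>(j', t'). replace_assortment j t \<mu> S j' t')" for S
    by (auto simp: replace_assortment_def fun_eq_iff)
  show ?thesis
    unfolding choice_process_def
    using assms by (subst Pi_pmf_condition_coordinate[of _ "(j, t)"]) (simp_all add: upd bind_assoc_pmf)
qed

lemma finite_set_choice_process:
  assumes "valid_arrivals I" "valid_choices I" "valid_policy I \<mu>"
  shows "finite (set_pmf (choice_process I \<mu>))"
proof -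
  have "finite (set_pmf (period_choice_pmf I \<mu> t))" if "t \<in> periods I" for t
    using set_period_choice_pmf[OF assms that] by (rule finite_subset) simp
  then show ?thesis
    by (simp add: choice_process_eq[OF assms(1)] set_Pi_pmf finite_PiE_dflt)
qed

lemma valid_policy_replace_assortment:
  assumes "valid_policy I \<mu>" "S \<subseteq> products I"
  shows "valid_policy I (replace_assortment j t \<mu> S)"
  using assms by (auto simp: valid_policy_def replace_assortment_def split: if_splits)

text \<open>Validity puts all the mass of \<open>\<mu> j t\<close> on subsets of
  \<open>products I\<close>, the only sets that \<open>support\<close> admits.\<close>

lemma support_eq_set_pmf:
  assumes "valid_policy I \<mu>" "j \<in> types I" "t \<in> periods I"
  shows "support I \<mu> j t = set_pmf (\<mu> j t)"
  using assms unfolding support_def valid_policy_def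
  by (auto simp: measure_pmf_single pmf_positive_iff)

lemma finite_support: "finite (support I \<mu> j t)"
  by (rule finite_subset[of _ "Pow (products I)"]) (auto simp: support_def)

theorem proposition3p1:
  fixes I :: instance_data and \<mu> :: policy and j t :: nat
  assumes "valid_instance I"
    and "valid_policy I \<mu>"
    and "j \<in> types I"
    and "t \<in> periods I"
  shows "expected_revenue I \<mu> \<le> (MAX S \<in> support I \<mu> j t. expected_revenue I (replace_assortment j t \<mu> S))"
proof -
  have valid: "valid_arrivals I" "valid_choices I"
    using assms(1) by (simp_all add: valid_instance_def)
  let ?\<Omega> = "support I \<mu> j t"
  let ?rev = "\<lambda>S. expected_revenue I (replace_assortment j t \<mu> S)"
  have \<Omega>: "set_pmf (\<mu> j t) \<subseteq> ?\<Omega>"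
    by (simp add: support_eq_set_pmf[OF assms(2-4)])
  \<comment> \<open>Finite support of each conditioned process lets the expectation over the mixture
    split into a weighted sum.\<close>
  have "finite (set_pmf (choice_process I (replace_assortment j t \<mu> S)))" if "S \<in> ?\<Omega>" for S
    using that by (intro finite_set_choice_process valid valid_policy_replace_assortment assms(2))
      (simp add: support_def)
  then have "expected_revenue I \<mu> = (\<Sum>S\<in>?\<Omega>. pmf (\<mu> j t) S * ?rev S)"
    unfolding expected_revenue_def choice_process_replace_assortment[OF assms(3,4), of \<mu>]
    by (subst pmf_expectation_bind[OF finite_support _ \<Omega>]) simp_all
  also have "\<dots> \<le> (\<Sum>S\<in>?\<Omega>. pmf (\<mu> j t) S * (MAX S\<in>?\<Omega>. ?rev S))"
    by (intro sum_mono mult_left_mono Max_ge) (auto simp: finite_support)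
  \<comment> \<open>The maximum is constant in \<open>S\<close>, and the weights sum to 1 because
    \<open>?\<Omega>\<close> carries all the mass.\<close>
  also have "\<dots> = (MAX S\<in>?\<Omega>. ?rev S)"
    by (simp add: sum_pmf_eq_1[OF finite_support \<Omega>] flip: sum_distrib_right)
  finally show ?thesis .
qed

end
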